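(* Let $X$ be a Banach space, $(A_n)_{n\in\mathbb{Z}}\subset B(X)$, $D\geqslant 1$, $\varepsilon\geqslant 0$ and $a,b\in\mathbb{R}$. Suppose that the equation $x_{n+1}=A_nx_n$, $n\in\mathbb{Z}$, admits a general dichotomy with bounds $$a_{m,n}=D(m-n+1)^a(|n|+1)^{\varepsilon}\ \ ((m,n)\in\mathbb{Z}^2_{\geqslant})\qquad\text{and}\qquad b_{m,n}=D(n-m+1)^b(|n|+1)^{\varepsilon}\ \ ((m,n)\in\mathbb{Z}^2_{\leqslant}).$$ Let $B_n:X\to X$, $n\in\mathbb{Z}$, be bounded linear operators such that $\|B_n\|\leqslant\delta(|n+1|+1)^{-\gamma}$ for all $n\in\mathbb{Z}$, for some $\delta>0$ and some $\gamma\in\mathbb{R}$. If $$a\leqslant b\leqslant 0,\qquad \varepsilon-\gamma<-1\qquad\text{and}\qquad \theta:=2^{-a}D\delta\left(2\zeta_{\gamma-\varepsilon}-1\right)<1,$$ where $\zeta_{\gamma-\varepsilon}:=\sum_{k=1}^{+\infty}k^{\varepsilon-\gamma}$, then the equation $x_{n+1}=(A_n+B_n)x_n$, $n\in\mathbb{Z}$, admits a general dichotomy with bounds $\frac{D}{1-\theta}(m-n+1)^a(|n|+1)^{\varepsilon}$ (for $(m,n)\in\mathbb{Z}^2_{\geqslant}$) and $\frac{D}{1-\theta}(n-m+1)^b(|n|+1)^{\varepsilon}$ (for $(m,n)\in\mathbb{Z}^2_{\leqslant}$).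
   Context: $B(X)$ is the space of bounded linear operators on the Banach space $X$. $\mathbb{Z}^2_{\geqslant}=\{(m,n)\in\mathbb{Z}^2: m\geqslant n\}$ and $\mathbb{Z}^2_{\leqslant}=\{(m,n)\in\mathbb{Z}^2: m\leqslant n\}$. For $(A_n)_{n\in\mathbb{Z}}\subset B(X)$ and $m\geqslant n$, put $\mathcal{A}_{m,n}=A_{m-1}\cdots A_n$ if $m>n$ and $\mathcal{A}_{n,n}=\mathrm{Id}$. The equation $x_{n+1}=A_nx_n$, $n\in\mathbb{Z}$, admits an invariant splitting if there are bounded projections $P_n\in B(X)$, $n\in\mathbb{Z}$, such that for every $(m,n)\in\mathbb{Z}^2_{\geqslant}$: (S1) $P_m\mathcal{A}_{m,n}=\mathcal{A}_{m,n}P_n$; (S2) $\mathcal{A}_{m,n}(\ker P_n)=\ker P_m$; (S3) $\mathcal{A}_{m,n}|_{\ker P_n}:\ker P_n\to\ker P_m$ is invertible (with bounded inverse). In that case, for $m\geqslant n$, $\mathcal{A}_{n,m}:\ker P_m\to\ker P_n$ denotes the inverse of $\mathcal{A}_{m,n}|_{\ker P_n}$, and $Q_n=\mathrm{Id}-P_n$. The equation admits a general dichotomy with bounds $(a_{m,n})_{(m,n)\in\mathbb{Z}^2_{\geqslant}}$ and $(b_{m,n})_{(m,n)\in\mathbb{Z}^2_{\leqslant}}$ if it admits an invariant splitting such that (D1) $\|\mathcal{A}_{m,n}P_n\|\leqslant a_{m,n}$ for all $(m,n)\in\mathbb{Z}^2_{\geqslant}$ and (D2) $\|\mathcal{A}_{m,n}Q_n\|\leqslant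 b_{m,n}$ for all $(m,n)\in\mathbb{Z}^2_{\leqslant}$. *)

theory Defs
  imports "HOL-Analysis.Analysis"
begin

definition ker :: "('a::real_normed_vector \<Rightarrow>\<^sub>L 'a) \<Rightarrow> 'a set" where
  "ker T = {x. blinfun_apply T x = 0}"

primrec forward_product :: "(int \<Rightarrow> 'a::real_normed_vector \<Rightarrow>\<^sub>L 'a) \<Rightarrow> int \<Rightarrow> nat \<Rightarrow> 'a \<Rightarrow>\<^sub>L 'a" where
  "forward_product A n 0 = id_blinfun"
| "forward_product A n (Suc k) = A (n + int k) o\<^sub>L forward_product A n k"

text \<open>The evolution operator \<open>A (m - 1) \<dots> A n\<close>; meaningful only for \<open>m \<ge> n\<close>
  (for \<open>m < n\<close> it is the identity by truncation, and is never used).\<close>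
definition evolution :: "(int \<Rightarrow> 'a::real_normed_vector \<Rightarrow>\<^sub>L 'a) \<Rightarrow> int \<Rightarrow> int \<Rightarrow> 'a \<Rightarrow>\<^sub>L 'a" where
  "evolution A m n = forward_product A n (nat (m - n))"

text \<open>For \<open>m \<le> n\<close>: the inverse \<open>ker (P n) \<rightarrow> ker (P m)\<close> of the restriction of
  \<open>evolution A n m\<close> to \<open>ker (P m)\<close>.  Values outside \<open>ker (P n)\<close> are irrelevant.\<close>
definition backward_evolution ::
  "(int \<Rightarrow> 'a::real_normed_vector \<Rightarrow>\<^sub>L 'a) \<Rightarrow> (int \<Rightarrow> 'a \<Rightarrow>\<^sub>L 'a) \<Rightarrow> int \<Rightarrow> int \<Rightarrow> 'a \<Rightarrow> 'a" where
  "backward_evolution A P m n = inv_into (ker (P m)) (blinfun_apply (evolution A n m))"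

text \<open>In the last clause the inverse of the restriction is automatically linear, so
  boundedness is the only requirement beyond bijectivity.\<close>
definition invariant_splitting ::
  "(int \<Rightarrow> 'a::real_normed_vector \<Rightarrow>\<^sub>L 'a) \<Rightarrow> (int \<Rightarrow> 'a \<Rightarrow>\<^sub>L 'a) \<Rightarrow> bool" where
  "invariant_splitting A P \<longleftrightarrow>
     (\<forall>n. P n o\<^sub>L P n = P n) \<and>
     (\<forall>m n. m \<ge> n \<longrightarrow>
        P m o\<^sub>L evolution A m n = evolution A m n o\<^sub>L P n \<and>
        blinfun_apply (evolution A m n) ` ker (P n) = ker (P m) \<and>
        bij_betw (blinfun_apply (evolution A m n)) (ker (P n)) (ker (P m)) \<and>
        (\<exists>K. \<forall>y\<in>ker (P m). norm (backward_evolution A P n m y) \<le> K * norm y))"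

text \<open>The map in the last clause is bounded and linear for an invariant splitting, so
  \<open>onorm\<close> is its operator norm.\<close>
definition general_dichotomy ::
  "(int \<Rightarrow> 'a::real_normed_vector \<Rightarrow>\<^sub>L 'a) \<Rightarrow> (int \<Rightarrow> int \<Rightarrow> real) \<Rightarrow> (int \<Rightarrow> int \<Rightarrow> real) \<Rightarrow> bool" where
  "general_dichotomy A \<alpha> \<beta> \<longleftrightarrow>
     (\<exists>P. invariant_splitting A P \<and>
        (\<forall>m n. m \<ge> n \<longrightarrow> norm (evolution A m n o\<^sub>L P n) \<le> \<alpha> m n) \<and>
        (\<forall>m n. m \<le> n \<longrightarrow>
           onorm (\<lambda>x. backward_evolution A P m n (blinfun_apply (id_blinfun - P n) x)) \<le> \<beta> m n))"

definition zeta_sum :: "real \<Rightarrow> real" where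
  "zeta_sum s = (\<Sum>k. real (Suc k) powr (- s))"

end

theory Submission
  imports Defs
begin

text \<open>A dichotomy is encoded by its Green function \<open>G\<close>. The Green function of the perturbed
  equation is the solution of \<open>G' m n = G m n + (\<Sum>\<^sub>\<infinity>k. G m (k + 1) B\<^sub>k G' k n)\<close>, a contraction with
  constant \<open>\<theta>\<close> both for the supremum norm in \<open>m\<close> weighted by the dichotomy bounds and for the
  unweighted one. The weighted estimate yields the bounds with factor \<open>1 / (1 - \<theta>)\<close> directly, and
  uniqueness among merely bounded solutions yields the algebraic identities making \<open>G'\<close> a Green
  function. Bounded solutions of the difference equation itself need not be unique (the bounds do
  not force decay), so every comparison is made at the level of the fixed-point equation.\<close>

section \<open>Operator composition and evolution operators\<close>

interpretation blinfun_compose: bounded_bilinear "(o\<^sub>L)"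
  by (rule bounded_bilinear_blinfun_compose)

lemma blinfun_compose_assoc: "(f o\<^sub>L g) o\<^sub>L h = f o\<^sub>L (g o\<^sub>L h)"
  by (rule blinfun_eqI) simp

lemma blinfun_compose_id [simp]: "id_blinfun o\<^sub>L f = f" "f o\<^sub>L id_blinfun = f"
  by (auto intro: blinfun_eqI)

lemma evolution_refl [simp]: "evolution A n n = id_blinfun"
  by (simp add: evolution_def)

lemma evolution_step_left:
  assumes "n \<le> m"
  shows "evolution A (m + 1) n = A m o\<^sub>L evolution A m n"
proof -
  have "nat (m + 1 - n) = Suc (nat (m - n))" "n + int (nat (m - n)) = m"
    using assms by auto
  then show ?thesis
    by (simp add: evolution_def)
qed

lemma evolution_step_right:
  assumes "n < m"
  shows "evolution A m n = evolution A m (n + 1) o\<^sub>L A n"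
proof -
  have "n + 1 \<le> m" using assms by simp
  then show ?thesis
  proof (induction m rule: int_ge_induct)
    case base
    then show ?case by (simp add: evolution_step_left)
  next
    case (step i)
    then show ?case by (simp add: evolution_step_left blinfun_compose_assoc)
  qed
qed

section \<open>Algebra of Green functions\<close>

text \<open>The Green function of a dichotomy is \<open>\<A>\<^bsub>m,n\<^esub> P\<^sub>n\<close> for \<open>m \<ge> n\<close> and
  \<open>- \<A>\<^bsub>m,n\<^esub> Q\<^sub>n\<close> for \<open>m < n\<close>. The projections are recovered as its diagonal, and the last clause
  is what makes that diagonal idempotent.\<close>
definition green_function ::
  "(int \<Rightarrow> 'a::real_normed_vector \<Rightarrow>\<^sub>L 'a) \<Rightarrow> (int \<Rightarrow> int \<Rightarrow> 'a \<Rightarrow>\<^sub>L 'a) \<Rightarrow> bool" where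
  "green_function A G \<longleftrightarrow>
     (\<forall>m n. G (m + 1) n = (A m o\<^sub>L G m n) + (if m + 1 = n then id_blinfun else 0)) \<and>
     (\<forall>m n. G m n = (G m (n + 1) o\<^sub>L A n) + (if m = n then id_blinfun else 0)) \<and>
     (\<forall>m n. m < n \<longrightarrow> G m n o\<^sub>L G n n = 0)"

lemma green_step_left:
  assumes "green_function A G"
  shows "G (m + 1) n = (A m o\<^sub>L G m n) + (if m + 1 = n then id_blinfun else 0)"
  by (rule assms[unfolded green_function_def, THEN conjunct1, THEN spec, THEN spec])

lemma green_step_right:
  assumes "green_function A G"
  shows "G m n = (G m (n + 1) o\<^sub>L A n) + (if m = n then id_blinfun else 0)"
  by (rule assms[unfolded green_function_def, THEN conjunct2, THEN conjunct1, THEN spec, THEN spec])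

lemma green_vanish: "green_function A G \<Longrightarrow> m < n \<Longrightarrow> G m n o\<^sub>L G n n = 0"
  unfolding green_function_def by blast

text \<open>The left difference equation is homogeneous except for the jump on arrival at
  \<open>n\<close>. The disjunction says that no step from \<open>l\<close> up to \<open>m\<close>
  arrives there.\<close>

lemma green_evolution_left:
  assumes G: "green_function A G" and "l \<le> m" and "n \<le> l \<or> m < n"
  shows "G m n = evolution A m l o\<^sub>L G l n"
  using assms(2,3)
proof (induction m rule: int_ge_induct)
  case base
  then show ?case by simp
next
  case (step i)
  have "G (i + 1) n = A i o\<^sub>L G i n"
    using step.hyps step.prems by (subst green_step_left[OF G]) auto
  also have "G i n = evolution A i l o\<^sub>L G l n"
    using step.prems by (intro step.IH) auto
  finally show ?case
    using step.hyps by (simp add: evolution_step_left blinfun_compose_assoc)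
qed

text \<open>In the second variable the jump sits at the index \<open>m\<close>; the disjunction
  keeps \<open>m\<close> out of the range \<open>l \<le> i < n\<close> of the steps.\<close>

lemma green_evolution_right:
  assumes G: "green_function A G" and "l \<le> n" and "m < l \<or> n \<le> m"
  shows "G m l = G m n o\<^sub>L evolution A n l"
  using assms(2,3)
proof (induction n rule: int_ge_induct)
  case base
  then show ?case by simp
next
  case (step i)
  have "G m l = G m i o\<^sub>L evolution A i l"
    using step.prems step.hyps by (intro step.IH) auto
  also have "G m i = G m (i + 1) o\<^sub>L A i"
    using step.hyps step.prems by (subst green_step_right[OF G]) auto
  finally show ?case
    using step.hyps by (simp add: evolution_step_left blinfun_compose_assoc)
qed

text \<open>The way up from \<open>m\<close> to \<open>n\<close> meets the jump only in its last
  step, hence a single \<open>id_blinfun\<close>. The right-hand side is minus the complementary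
  projection at \<open>n\<close>.\<close>

lemma evolution_green_above:
  assumes G: "green_function A G" and "m < n"
  shows "evolution A n m o\<^sub>L G m n = G n n - id_blinfun"
proof -
  have "evolution A n m = A (n - 1) o\<^sub>L evolution A (n - 1) m"
    using evolution_step_left[of m "n - 1" A] assms(2) by simp
  moreover have "G (n - 1) n = evolution A (n - 1) m o\<^sub>L G m n"
    using assms by (intro green_evolution_left) auto
  ultimately show ?thesis
    using green_step_left[OF G, of "n - 1" n] by (simp add: blinfun_compose_assoc)
qed

text \<open>Here the jump is met at the rightmost factor \<open>A m\<close>, so the complementary
  projection appears at \<open>m\<close>.\<close>

lemma green_evolution_above:
  assumes G: "green_function A G" and "m < n"
  shows "G m n o\<^sub>L evolution A n m = G m m - id_blinfun"
proof -
  have "evolution A n m = evolution A n (m + 1) o\<^sub>L A m"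
    using assms(2) by (rule evolution_step_right)
  moreover have "G m (m + 1) = G m n o\<^sub>L evolution A n (m + 1)"
    using assms by (intro green_evolution_right) auto
  ultimately show ?thesis
    using green_step_right[OF G, of m m] by (simp add: blinfun_compose_assoc)
qed

text \<open>The difference equation splits the left factor into a multiple of
  \<open>G (n - 1) n\<close>, which the vanishing clause kills, and the jump, which reproduces
  \<open>G n n\<close>.\<close>

lemma green_idem:
  assumes G: "green_function A G"
  shows "G n n o\<^sub>L G n n = G n n"
proof -
  have "G n n = (A (n - 1) o\<^sub>L G (n - 1) n) + id_blinfun"
    using green_step_left[OF G, of "n - 1" n] by simp
  then have "G n n o\<^sub>L G n n = ((A (n - 1) o\<^sub>L G (n - 1) n) + id_blinfun) o\<^sub>L G n n"
    by simp
  also have "\<dots> = G n n"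
    by (simp add: blinfun_compose.add_left blinfun_compose_assoc green_vanish[OF G])
  finally show ?thesis .
qed

text \<open>The mirror image of the vanishing clause, with the diagonal factor on the left. It
  reduces to that clause because an evolution can be moved from one side of \<open>G m n\<close> to
  the other.\<close>

lemma green_diag_vanish:
  assumes G: "green_function A G" and "m < n"
  shows "G m m o\<^sub>L G m n = 0"
proof -
  have "G m m = (G m n o\<^sub>L evolution A n m) + id_blinfun"
    using green_evolution_above[OF assms] by simp
  then have "G m m o\<^sub>L G m n = (G m n o\<^sub>L (evolution A n m o\<^sub>L G m n)) + G m n"
    by (simp add: blinfun_compose.add_left blinfun_compose_assoc)
  also have "\<dots> = 0"
    by (simp add: evolution_green_above[OF assms] blinfun_compose.diff_right green_vanish[OF assms])
  finally show ?thesis .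
qed

text \<open>The values of \<open>G n l\<close> lie in the range of the projection
  \<open>G n n\<close> if \<open>l \<le> n\<close> and in its kernel otherwise; \<open>G m n\<close>
  kills the kernel if \<open>n \<le> m\<close> and the range otherwise. The minus sign stems from
  the sign convention above the diagonal, which enters twice on the left and once on the
  right.\<close>

lemma green_compose:
  assumes G: "green_function A G"
  shows "G m n o\<^sub>L G n l =
    (if l \<le> n then (if n \<le> m then G m l else 0) else (if n \<le> m then 0 else - G m l))"
proof (cases "l \<le> n")
  case True
  have Gnl: "G n l = G n n o\<^sub>L evolution A n l"
    using True by (intro green_evolution_right[OF G]) auto
  show ?thesis
  proof (cases "n \<le> m")
    case nm: True
    have "G m n = evolution A m n o\<^sub>L G n n" "G m l = evolution A m n o\<^sub>L G n l"
      using nm True by (auto intro!: green_evolution_left[OF G])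
    then show ?thesis
      using True nm by (metis (no_types) Gnl blinfun_compose_assoc green_idem[OF G])
  next
    case False
    then show ?thesis
      using True by (simp add: Gnl green_vanish[OF G] flip: blinfun_compose_assoc)
  qed
next
  case False
  show ?thesis
  proof (cases "n \<le> m")
    case nm: True
    have "G m n = evolution A m n o\<^sub>L G n n"
      using nm by (auto intro!: green_evolution_left[OF G])
    then show ?thesis
      using False nm by (simp add: blinfun_compose_assoc green_diag_vanish[OF G])
  next
    case nm: False
    \<comment> \<open>Both factors point backwards, so the right one is pushed up to
      \<open>n\<close> from \<open>m\<close> in order that its evolution meets
      \<open>G m n\<close>.\<close>
    have "G n l = evolution A n m o\<^sub>L G m l"
      using nm False by (intro green_evolution_left[OF G]) auto
    then have "G m n o\<^sub>L G n l = (G m n o\<^sub>L evolution A n m) o\<^sub>L G m l"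
      by (simp add: blinfun_compose_assoc)
    also have "\<dots> = - G m l"
      using nm False
      by (simp add: green_evolution_above[OF G] blinfun_compose.diff_left green_diag_vanish[OF G])
    finally show ?thesis using nm False by simp
  qed
qed

section \<open>Equivalence of dichotomies and Green functions\<close>

text \<open>The diagonal needs a bound of its own: there \<open>G n n\<close> is the projection
  bounded by \<open>\<alpha>\<close>, while the second dichotomy bound concerns
  \<open>id_blinfun - G n n\<close>.\<close>

lemma general_dichotomy_if_green:
  assumes G: "green_function A G"
    and \<alpha>: "\<And>m n. n \<le> m \<Longrightarrow> norm (G m n) \<le> \<alpha> m n"
    and \<beta>: "\<And>m n. m < n \<Longrightarrow> norm (G m n) \<le> \<beta> m n"
    and \<beta>_diag: "\<And>n. norm (id_blinfun - G n n) \<le> \<beta> n n"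
  shows "general_dichotomy A \<alpha> \<beta>"
proof -
  define P where "P n = G n n" for n
  \<comment> \<open>\<open>V m n\<close> plays the role of the backward evolution preceded by the
    complementary projection, defined on the whole space. The next four facts make it a two-sided
    inverse of the evolution between the kernels.\<close>
  define V where "V m n = (if m = n then id_blinfun - G n n else - G m n)" for m n
  have P_idem: "P n o\<^sub>L P n = P n" for n
    by (simp add: P_def green_idem[OF G])
  have P_comm: "P m o\<^sub>L evolution A m n = evolution A m n o\<^sub>L P n" if "n \<le> m" for m n
    using green_evolution_left[OF G, of n m n] green_evolution_right[OF G, of n m m] that
    by (simp add: P_def)
  have EV: "evolution A n m o\<^sub>L V m n = id_blinfun - P n" if "m \<le> n" for m n
    using that evolution_green_above[OF G, of m n]
    by (auto simp: V_def P_def blinfun_compose.minus_right)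
  have VE: "V m n o\<^sub>L evolution A n m = id_blinfun - P m" if "m \<le> n" for m n
    using that green_evolution_above[OF G, of m n]
    by (auto simp: V_def P_def blinfun_compose.minus_left)
  have PV: "P m o\<^sub>L V m n = 0" if "m \<le> n" for m n
    using that green_diag_vanish[OF G, of m n]
    by (auto simp: V_def P_def blinfun_compose.minus_right blinfun_compose.diff_right green_idem[OF G])
  have VP: "V m n o\<^sub>L P n = 0" if "m \<le> n" for m n
    using that green_vanish[OF G, of m n]
    by (auto simp: V_def P_def blinfun_compose.minus_left blinfun_compose.diff_left green_idem[OF G])
  have E_ker: "evolution A m n x \<in> ker (P m)" if "n \<le> m" "x \<in> ker (P n)" for m n x
    using arg_cong[OF P_comm[OF that(1)], of "\<lambda>T. blinfun_apply T x"] that(2)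
    by (simp add: ker_def)
  have V_ker: "V m n x \<in> ker (P m)" if "m \<le> n" for m n x
    using arg_cong[OF PV[OF that], of "\<lambda>T. blinfun_apply T x"] by (simp add: ker_def)
  have EV_ker: "evolution A n m (V m n x) = x" if "m \<le> n" "x \<in> ker (P n)" for m n x
    using arg_cong[OF EV[OF that(1)], of "\<lambda>T. blinfun_apply T x"] that(2)
    by (simp add: ker_def blinfun.diff_left)
  have VE_ker: "V m n (evolution A n m x) = x" if "m \<le> n" "x \<in> ker (P m)" for m n x
    using arg_cong[OF VE[OF that(1)], of "\<lambda>T. blinfun_apply T x"] that(2)
    by (simp add: ker_def blinfun.diff_left)
  have bij: "bij_betw (evolution A m n) (ker (P n)) (ker (P m))" if "n \<le> m" for m n
    using that by (intro bij_betw_byWitness[where f' = "V n m"]) (auto simp: E_ker V_ker EV_ker VE_ker)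
  have bwd: "backward_evolution A P m n y = V m n y" if "m \<le> n" "y \<in> ker (P n)" for m n y
    unfolding backward_evolution_def
    using bij[OF that(1)] that by (intro inv_into_f_eq) (auto simp: bij_betw_def V_ker EV_ker)
  have Q_ker: "(id_blinfun - P n) x \<in> ker (P n)" for n x
    using arg_cong[OF P_idem, of "\<lambda>T. blinfun_apply T x"]
    by (simp add: ker_def blinfun.diff_left blinfun.diff_right)
  \<comment> \<open>\<open>V m n\<close> annihilates the range of \<open>P n\<close>, so inserting
    the complementary projection in front of it changes nothing.\<close>
  have back_Q: "backward_evolution A P m n ((id_blinfun - P n) x) = V m n x" if "m \<le> n" for m n x
    using arg_cong[OF VP[OF that], of "\<lambda>T. blinfun_apply T x"]
    by (simp only: bwd[OF that Q_ker]) (simp add: blinfun.diff_left blinfun.diff_right)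
  have "invariant_splitting A P"
    unfolding invariant_splitting_def
  proof (intro conjI allI impI)
    fix m n :: int assume "n \<le> m"
    then show "\<exists>K. \<forall>y\<in>ker (P m). norm (backward_evolution A P n m y) \<le> K * norm y"
      by (intro exI[of _ "norm (V n m)"]) (simp add: bwd norm_blinfun)
  qed (use bij P_comm P_idem in \<open>auto simp: bij_betw_def\<close>)
  moreover have "norm (evolution A m n o\<^sub>L P n) \<le> \<alpha> m n" if "n \<le> m" for m n
    using \<alpha>[OF that] green_evolution_left[OF G, of n m n] that by (simp add: P_def)
  moreover have "onorm (\<lambda>x. backward_evolution A P m n ((id_blinfun - P n) x)) \<le> \<beta> m n"
    if "m \<le> n" for m n
    using \<beta>[of m n] \<beta>_diag[of n] that
    by (auto simp: back_Q V_def norm_blinfun.rep_eq[symmetric])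
  ultimately show ?thesis
    unfolding general_dichotomy_def by blast
qed

text \<open>The backward evolution is only a set-theoretic inverse on a kernel. The main work is to
  show that, preceded by the complementary projection, it is a bounded operator on the whole
  space.\<close>

lemma green_if_general_dichotomy:
  assumes "general_dichotomy A \<alpha> \<beta>"
  obtains G where "green_function A G"
    and "\<And>m n. n \<le> m \<Longrightarrow> norm (G m n) \<le> \<alpha> m n"
    and "\<And>m n. m < n \<Longrightarrow> norm (G m n) \<le> \<beta> m n"
    and "\<And>n. norm (id_blinfun - G n n) \<le> \<beta> n n"
proof -
  obtain P where split: "invariant_splitting A P"
    and \<alpha>: "\<And>m n. n \<le> m \<Longrightarrow> norm (evolution A m n o\<^sub>L P n) \<le> \<alpha> m n"
    and \<beta>: "\<And>m n. m \<le> n \<Longrightarrow>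
      onorm (\<lambda>x. backward_evolution A P m n ((id_blinfun - P n) x)) \<le> \<beta> m n"
    using assms unfolding general_dichotomy_def by blast
  have P_idem: "P n (P n x) = P n x" for n x
    using split unfolding invariant_splitting_def by (metis blinfun_apply_blinfun_compose)
  have P_comm: "P m o\<^sub>L evolution A m n = evolution A m n o\<^sub>L P n" if "n \<le> m" for m n
    using split that unfolding invariant_splitting_def by blast
  have bij: "bij_betw (evolution A m n) (ker (P n)) (ker (P m))" if "n \<le> m" for m n
    using split that unfolding invariant_splitting_def by blast
  have A_comm: "P (n + 1) (A n x) = A n (P n x)" for n x
    using arg_cong[OF P_comm[of n "n + 1"], of "\<lambda>T. blinfun_apply T x"]
    by (simp add: evolution_step_left)
  have ker_A: "A n x \<in> ker (P (n + 1))" if "x \<in> ker (P n)" for n x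
    using that by (simp add: ker_def A_comm)
  define bwd where "bwd = backward_evolution A P"
  define Q where "Q n = id_blinfun - P n" for n
  have Q_ker: "Q n x \<in> ker (P n)" for n x
    by (simp add: Q_def ker_def blinfun.diff_left blinfun.diff_right P_idem)
  have Q_A: "Q (n + 1) (A n x) = A n (Q n x)" for n x
    by (simp add: Q_def A_comm blinfun.diff_left blinfun.diff_right)
  have back_ker: "bwd m n y \<in> ker (P m)" and E_back: "evolution A n m (bwd m n y) = y"
    if "m \<le> n" "y \<in> ker (P n)" for m n y
    using bij[OF that(1)] that(2)
    by (auto simp: bwd_def backward_evolution_def bij_betw_def intro: inv_into_into f_inv_into_f)
  \<comment> \<open>Injectivity on the kernel reduces every identity about \<open>bwd\<close> to
    exhibiting the right preimage.\<close>
  have back_eqI: "bwd m n y = u" if "m \<le> n" "u \<in> ker (P m)" "evolution A n m u = y" for m n u y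
    using bij[OF that(1)] that
    unfolding bwd_def backward_evolution_def by (intro inv_into_f_eq) (auto simp: bij_betw_def)
  have lin: "bounded_linear (\<lambda>x. bwd m n (Q n x))" if mn: "m \<le> n" for m n
  proof -
    obtain K where K: "\<And>y. y \<in> ker (P n) \<Longrightarrow> norm (bwd m n y) \<le> K * norm y"
      using split mn unfolding invariant_splitting_def bwd_def by blast
    show ?thesis
    proof (rule bounded_linear_intro)
      show "bwd m n (Q n (x + y)) = bwd m n (Q n x) + bwd m n (Q n y)" for x y
        using back_ker[OF mn Q_ker, of x] back_ker[OF mn Q_ker, of y] E_back[OF mn Q_ker]
        by (intro back_eqI[OF mn]) (auto simp: ker_def blinfun.add_right)
      show "bwd m n (Q n (r *\<^sub>R x)) = r *\<^sub>R bwd m n (Q n x)" for r x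
        using back_ker[OF mn Q_ker, of x] E_back[OF mn Q_ker]
        by (intro back_eqI[OF mn]) (auto simp: ker_def blinfun.scaleR_right)
      show "norm (bwd m n (Q n x)) \<le> norm x * (\<bar>K\<bar> * norm (Q n))" for x
      proof -
        have "norm (bwd m n (Q n x)) \<le> K * norm (Q n x)" by (rule K[OF Q_ker])
        \<comment> \<open>The definition of a splitting does not fix the sign of \<open>K\<close>,
          hence the absolute value.\<close>
        also have "\<dots> \<le> \<bar>K\<bar> * (norm (Q n) * norm x)"
          by (intro mult_mono norm_blinfun) auto
        finally show ?thesis by (simp add: mult_ac)
      qed
    qed
  qed
  define V where "V m n = Blinfun (\<lambda>x. bwd m n (Q n x))" for m n
  have V: "V m n x = bwd m n (Q n x)" if "m \<le> n" for m n x
    by (simp add: V_def bounded_linear_Blinfun_apply[OF lin[OF that]])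
  have norm_V: "norm (V m n) \<le> \<beta> m n" if "m \<le> n" for m n
  proof -
    have "blinfun_apply (V m n) = (\<lambda>x. bwd m n (Q n x))"
      using V[OF that] by auto
    then show ?thesis
      using \<beta>[OF that] by (simp add: norm_blinfun.rep_eq bwd_def Q_def)
  qed
  have V_diag: "V n n = Q n" for n
    by (rule blinfun_eqI) (simp add: V back_eqI Q_ker)
  have A_V: "A m o\<^sub>L V m n = V (m + 1) n" if "m < n" for m n
  proof (rule blinfun_eqI)
    fix x
    have "evolution A n m (V m n x) = Q n x"
      using that by (simp add: V E_back Q_ker)
    then have "bwd (m + 1) n (Q n x) = A m (V m n x)"
      using that by (intro back_eqI) (auto simp: V ker_A back_ker Q_ker evolution_step_right)
    then show "(A m o\<^sub>L V m n) x = V (m + 1) n x"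
      using that by (simp add: V)
  qed
  have V_A: "V m (n + 1) o\<^sub>L A n = V m n" if "m \<le> n" for m n
  proof (rule blinfun_eqI)
    fix x
    have "bwd m (n + 1) (Q (n + 1) (A n x)) = V m n x"
      using that by (intro back_eqI) (auto simp: V Q_A E_back back_ker Q_ker evolution_step_left)
    then show "(V m (n + 1) o\<^sub>L A n) x = V m n x"
      using that by (simp add: V)
  qed
  have V_P: "V m n o\<^sub>L P n = 0" if "m \<le> n" for m n
  proof (rule blinfun_eqI)
    fix x
    have "V m n (P n x) = bwd m n 0"
      using that by (simp add: V Q_def blinfun.diff_left P_idem)
    also have "\<dots> = 0"
      using that by (intro back_eqI) (auto simp: ker_def)
    finally show "(V m n o\<^sub>L P n) x = blinfun_apply 0 x" by simp
  qed
  \<comment> \<open>The diagonal belongs to the forward branch, so that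
    \<open>G n n = P n\<close>.\<close>
  define G where "G m n = (if n \<le> m then evolution A m n o\<^sub>L P n else - V m n)" for m n
  have "green_function A G"
    unfolding green_function_def
  proof (intro conjI allI impI)
    fix m n :: int
    \<comment> \<open>In the middle case the jump comes from \<open>P n + Q n = id_blinfun\<close>:
      the forward branch starts with \<open>P n\<close>, while \<open>A m\<close> carries the
      backward branch to \<open>- Q n\<close>.\<close>
    consider "n \<le> m" | "n = m + 1" | "m + 1 < n" by linarith
    then show "G (m + 1) n = (A m o\<^sub>L G m n) + (if m + 1 = n then id_blinfun else 0)"
      by cases (auto simp: G_def evolution_step_left blinfun_compose_assoc
          blinfun_compose.minus_right A_V V_diag Q_def)
  next
    fix m n :: int
    have "evolution A m (n + 1) o\<^sub>L P (n + 1) o\<^sub>L A n = evolution A m n o\<^sub>L P n" if "n < m"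
      using that P_comm[of n "n + 1"]
      by (simp add: evolution_step_right blinfun_compose_assoc evolution_step_left)
    then show "G m n = (G m (n + 1) o\<^sub>L A n) + (if m = n then id_blinfun else 0)"
      by (auto simp: G_def blinfun_compose.minus_left V_A V_diag Q_def)
  next
    fix m n :: int assume "m < n"
    then show "G m n o\<^sub>L G n n = 0"
      by (simp add: G_def blinfun_compose.minus_left V_P)
  qed
  moreover have "norm (G m n) \<le> \<alpha> m n" if "n \<le> m" for m n
    using \<alpha>[OF that] that by (simp add: G_def)
  moreover have "norm (G m n) \<le> \<beta> m n" if "m < n" for m n
    using norm_V[of m n] that by (simp add: G_def)
  moreover have "norm (id_blinfun - G n n) \<le> \<beta> n n" for n
    using norm_V[of n n] by (simp add: G_def V_diag Q_def)
  ultimately show thesis by (rule that)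
qed

section \<open>Summable kernels and their fixed-point equations\<close>

lemma summable_on_dominated:
  fixes f :: "'i \<Rightarrow> 'b::banach"
  assumes "c summable_on UNIV" and "\<And>k. norm (f k) \<le> S * c k"
  shows "f summable_on UNIV" and "norm (infsum f UNIV) \<le> S * infsum c UNIV"
proof -
  have Sc: "(\<lambda>k. S * c k) summable_on UNIV"
    using assms(1) by (rule summable_on_cmult_right)
  have "f abs_summable_on UNIV"
    by (rule Infinite_Sum.abs_summable_on_comparison_test'[OF Sc]) (use assms(2) in auto)
  then show f: "f summable_on UNIV"
    by (rule abs_summable_summable)
  have "norm (infsum f UNIV) \<le> infsum (\<lambda>k. S * c k) UNIV"
    by (rule norm_infsum_le[OF has_sum_infsum[OF f] has_sum_infsum[OF Sc]]) (use assms(2) in auto)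
  then show "norm (infsum f UNIV) \<le> S * infsum c UNIV"
    using assms(1) by (simp add: infsum_cmult_right)
qed

text \<open>A weighted Schur-type test. The hypothesis on \<open>K\<close> trades the weight at
  \<open>k\<close> for the weight at \<open>m\<close> at the cost of \<open>c k\<close>, which is
  independent of \<open>m\<close>; so the kernel acts on the \<open>h\<close>-weighted supremum norm
  with constant \<open>infsum c UNIV\<close>.\<close>

lemma kernel_infsum:
  fixes K :: "int \<Rightarrow> int \<Rightarrow> 'a::banach \<Rightarrow>\<^sub>L 'a" and W :: "int \<Rightarrow> 'a \<Rightarrow>\<^sub>L 'a"
  assumes K: "\<And>m k. norm (K m k) * h k \<le> c k * h m" and c: "c summable_on UNIV"
    and W: "\<And>k. norm (W k) \<le> S * h k" and S: "0 \<le> S"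
  shows "(\<lambda>k. K m k o\<^sub>L W k) summable_on UNIV"
    and "norm (\<Sum>\<^sub>\<infinity>k. K m k o\<^sub>L W k) \<le> S * h m * infsum c UNIV"
proof -
  have le: "norm (K m k o\<^sub>L W k) \<le> S * h m * c k" for k
  proof -
    have "norm (K m k o\<^sub>L W k) \<le> norm (K m k) * (S * h k)"
      by (intro order_trans[OF norm_blinfun_compose] mult_left_mono W) simp
    also have "\<dots> \<le> S * h m * c k"
      using mult_left_mono[OF K[of m k] S] by (simp add: mult_ac)
    finally show ?thesis .
  qed
  show "(\<lambda>k. K m k o\<^sub>L W k) summable_on UNIV"
    by (rule summable_on_dominated(1)[OF c le])
  show "norm (\<Sum>\<^sub>\<infinity>k. K m k o\<^sub>L W k) \<le> S * h m * infsum c UNIV"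
    by (rule summable_on_dominated(2)[OF c le])
qed

lemma infsum_compose_diff:
  fixes K :: "'i \<Rightarrow> 'a::banach \<Rightarrow>\<^sub>L 'a" and U V :: "'i \<Rightarrow> 'a \<Rightarrow>\<^sub>L 'a"
  assumes "(\<lambda>k. K k o\<^sub>L U k) summable_on UNIV" "(\<lambda>k. K k o\<^sub>L V k) summable_on UNIV"
  shows "(\<Sum>\<^sub>\<infinity>k. K k o\<^sub>L (U k - V k)) = (\<Sum>\<^sub>\<infinity>k. K k o\<^sub>L U k) - (\<Sum>\<^sub>\<infinity>k. K k o\<^sub>L V k)"
  using infsum_add[OF assms(1) summable_on_uminus[THEN iffD2, OF assms(2)]]
  by (simp add: blinfun_compose.diff_right infsum_uminus)

text \<open>The solution is the Neumann series, whose geometric majorant also gives the factor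
  \<open>1 / (1 - \<theta>)\<close>.\<close>

lemma kernel_fixpoint_exists:
  fixes K :: "int \<Rightarrow> int \<Rightarrow> 'a::banach \<Rightarrow>\<^sub>L 'a" and g :: "int \<Rightarrow> 'a \<Rightarrow>\<^sub>L 'a"
  assumes K: "\<And>m k. norm (K m k) * h k \<le> c k * h m" and h: "\<And>m. 0 < h m"
    and c: "c summable_on UNIV" "infsum c UNIV = \<theta>" "0 \<le> \<theta>" "\<theta> < 1"
    and g: "\<And>m. norm (g m) \<le> h m"
  obtains W where "\<And>m. W m = g m + (\<Sum>\<^sub>\<infinity>k. K m k o\<^sub>L W k)"
    and "\<And>m. norm (W m) \<le> h m / (1 - \<theta>)"
proof -
  \<comment> \<open>\<open>t j\<close> is the kernel operator applied \<open>j\<close> times to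
    \<open>g\<close>.\<close>
  define t where "t = rec_nat g (\<lambda>_ U m. \<Sum>\<^sub>\<infinity>k. K m k o\<^sub>L U k)"
  have t_0: "t 0 = g" and t_Suc: "t (Suc j) m = (\<Sum>\<^sub>\<infinity>k. K m k o\<^sub>L t j k)" for j m
    by (simp_all add: t_def)
  have t_le: "norm (t j m) \<le> \<theta> ^ j * h m" for j m
  proof (induction j arbitrary: m)
    case 0
    then show ?case using g by (simp add: t_0)
  next
    case (Suc j)
    have "norm (t (Suc j) m) \<le> \<theta> ^ j * h m * \<theta>"
      using kernel_infsum(2)[OF K c(1) Suc] c(2,3) by (simp add: t_Suc)
    then show ?case by (simp add: mult_ac)
  qed
  have geo: "(\<lambda>j. \<theta> ^ (j + N) * h m) sums (\<theta> ^ N / (1 - \<theta>) * h m)" for N m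
    using sums_mult2[OF geometric_sums[of \<theta>], of "\<theta> ^ N * h m"] c(3,4)
    by (simp add: power_add mult_ac)
  have t_abs: "summable (\<lambda>j. norm (t (j + N) m))" for N m
    by (rule summable_comparison_test'[OF sums_summable[OF geo[of N m]]]) (use t_le in auto)
  define W where "W m = (\<Sum>j. t j m)" for m
  define s where "s N m = (\<Sum>j<N. t j m)" for N m
  \<comment> \<open>The tail estimate serves twice: \<open>N = 0\<close> bounds the solution, and
    \<open>N\<close> tending to infinity yields the equation.\<close>
  have W_s: "norm (W m - s N m) \<le> \<theta> ^ N / (1 - \<theta>) * h m" for N m
  proof -
    have "summable (\<lambda>j. t j m)"
      using summable_norm_cancel[OF t_abs[of 0 m]] by simp
    then have "W m - s N m = (\<Sum>j. t (j + N) m)"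
      using suminf_split_initial_segment[of "\<lambda>j. t j m" N] by (simp add: W_def s_def)
    also have "norm \<dots> \<le> (\<Sum>j. norm (t (j + N) m))"
      by (rule summable_norm[OF t_abs])
    also have "\<dots> \<le> \<theta> ^ N / (1 - \<theta>) * h m"
      unfolding sums_unique[OF geo]
      by (rule suminf_le[OF _ t_abs sums_summable[OF geo]]) (rule t_le)
    finally show ?thesis .
  qed
  have W_le: "norm (W m) \<le> 1 / (1 - \<theta>) * h m" for m
    using W_s[of m 0] by (simp add: s_def)
  have S: "0 \<le> \<theta> ^ N / (1 - \<theta>)" for N
    using c(3,4) by simp
  have W_summable: "(\<lambda>k. K m k o\<^sub>L W k) summable_on UNIV" for m
    using S[of 0] by (intro kernel_infsum(1)[OF K c(1) W_le]) simp
  have t_summable: "(\<lambda>k. K m k o\<^sub>L t j k) summable_on UNIV" for m j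
    using c(3) by (intro kernel_infsum(1)[OF K c(1) t_le]) simp
  have s_Suc: "s (Suc N) m = g m + (\<Sum>\<^sub>\<infinity>k. K m k o\<^sub>L s N k)"
    and s_summable: "(\<lambda>k. K m k o\<^sub>L s N k) summable_on UNIV" for N m
  proof -
    have "((\<lambda>k. \<Sum>j<N. K m k o\<^sub>L t j k) has_sum (\<Sum>j<N. t (Suc j) m)) UNIV"
    proof (induction N)
      case (Suc N)
      have "((\<lambda>k. K m k o\<^sub>L t N k) has_sum t (Suc N) m) UNIV"
        unfolding t_Suc by (rule has_sum_infsum[OF t_summable])
      with Suc show ?case by (simp add: has_sum_add)
    qed simp
    then have *: "((\<lambda>k. K m k o\<^sub>L s N k) has_sum (\<Sum>j<N. t (Suc j) m)) UNIV"
      by (simp add: s_def blinfun_compose.sum_right)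
    then show "(\<lambda>k. K m k o\<^sub>L s N k) summable_on UNIV"
      by (rule has_sum_imp_summable)
    show "s (Suc N) m = g m + (\<Sum>\<^sub>\<infinity>k. K m k o\<^sub>L s N k)"
      unfolding infsumI[OF *] unfolding s_def by (simp add: sum.lessThan_Suc_shift t_0 del: sum.lessThan_Suc)
  qed
  \<comment> \<open>No interchange of the two infinite sums is needed: the partial sums satisfy the
    equation up to an index shift, and the defect of \<open>W\<close> is estimated through its
    distances to \<open>s N\<close> and \<open>s (Suc N)\<close>.\<close>
  have "W m = g m + (\<Sum>\<^sub>\<infinity>k. K m k o\<^sub>L W k)" for m
  proof -
    let ?d = "W m - (g m + (\<Sum>\<^sub>\<infinity>k. K m k o\<^sub>L W k))"
    have "norm ?d \<le> 2 * (\<theta> ^ N * (h m / (1 - \<theta>)))" for N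
    proof -
      have "?d = (W m - s (Suc N) m) - (\<Sum>\<^sub>\<infinity>k. K m k o\<^sub>L (W k - s N k))"
        by (simp add: s_Suc infsum_compose_diff[OF W_summable s_summable])
      also have "norm \<dots> \<le> norm (W m - s (Suc N) m) + norm (\<Sum>\<^sub>\<infinity>k. K m k o\<^sub>L (W k - s N k))"
        by (rule norm_triangle_ineq4)
      also have "\<dots> \<le> \<theta> ^ Suc N / (1 - \<theta>) * h m + \<theta> ^ N / (1 - \<theta>) * h m * \<theta>"
        using kernel_infsum(2)[OF K c(1) W_s S] c(2) by (intro add_mono W_s) simp
      also have "\<dots> = 2 * (\<theta> ^ N * (h m / (1 - \<theta>))) * \<theta>"
        by (simp add: field_simps)
      also have "\<dots> \<le> 2 * (\<theta> ^ N * (h m / (1 - \<theta>)))"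
        using c(3,4) h[of m] by (intro mult_left_le) auto
      finally show ?thesis .
    qed
    moreover have "(\<lambda>N. 2 * (\<theta> ^ N * (h m / (1 - \<theta>)))) \<longlonglongrightarrow> 2 * (0 * (h m / (1 - \<theta>)))"
      using c(3,4) by (intro tendsto_intros LIMSEQ_realpow_zero) auto
    ultimately have "norm ?d \<le> 2 * (0 * (h m / (1 - \<theta>)))"
      by (intro LIMSEQ_le_const) auto
    then show ?thesis by simp
  qed
  moreover have "norm (W m) \<le> h m / (1 - \<theta>)" for m
    using W_le[of m] by simp
  ultimately show thesis by (rule that)
qed

text \<open>The difference of two solutions is reproduced by the kernel operator, so its bound
  shrinks by \<open>\<theta>\<close> with each application. The weight is constant here, so
  boundedness in \<open>m\<close> is all that is asked of the competitors.\<close>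

lemma kernel_fixpoint_unique:
  fixes K :: "int \<Rightarrow> int \<Rightarrow> 'a::banach \<Rightarrow>\<^sub>L 'a" and g U V :: "int \<Rightarrow> 'a \<Rightarrow>\<^sub>L 'a"
  assumes K: "\<And>m k. norm (K m k) \<le> c k"
    and c: "c summable_on UNIV" "infsum c UNIV = \<theta>" "0 \<le> \<theta>" "\<theta> < 1"
    and U: "\<And>m. norm (U m) \<le> C" "\<And>m. U m = g m + (\<Sum>\<^sub>\<infinity>k. K m k o\<^sub>L U k)"
    and V: "\<And>m. norm (V m) \<le> C'" "\<And>m. V m = g m + (\<Sum>\<^sub>\<infinity>k. K m k o\<^sub>L V k)"
  shows "U = V"
proof
  fix m
  have K1: "norm (K m k) * 1 \<le> c k * 1" for m k
    using K by simp
  have C: "0 \<le> C" "0 \<le> C'"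
    using order_trans[OF norm_ge_zero U(1)] order_trans[OF norm_ge_zero V(1)] by auto
  have fix_diff: "U m - V m = (\<Sum>\<^sub>\<infinity>k. K m k o\<^sub>L (U k - V k))" for m
  proof -
    have "(\<Sum>\<^sub>\<infinity>k. K m k o\<^sub>L (U k - V k)) = (\<Sum>\<^sub>\<infinity>k. K m k o\<^sub>L U k) - (\<Sum>\<^sub>\<infinity>k. K m k o\<^sub>L V k)"
      using kernel_infsum(1)[OF K1 c(1), of U C] kernel_infsum(1)[OF K1 c(1), of V C'] U(1) V(1) C
      by (intro infsum_compose_diff) auto
    then show ?thesis
      by (subst U(2), subst V(2)) simp
  qed
  have "norm (U m - V m) \<le> (C + C') * \<theta> ^ j" for j m
  proof (induction j arbitrary: m)
    case 0
    then show ?case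
      using norm_triangle_le_diff[of "U m" "V m" "C + C'"] U(1)[of m] V(1)[of m] by simp
  next
    case (Suc j)
    then have "norm (\<Sum>\<^sub>\<infinity>k. K m k o\<^sub>L (U k - V k)) \<le> (C + C') * \<theta> ^ j * 1 * infsum c UNIV"
      using C c(3) by (intro kernel_infsum(2)[OF K1 c(1)]) auto
    then show ?case
      by (subst fix_diff) (simp add: c(2) mult_ac)
  qed
  moreover have "(\<lambda>j. (C + C') * \<theta> ^ j) \<longlonglongrightarrow> (C + C') * 0"
    using c(3,4) by (intro tendsto_intros LIMSEQ_realpow_zero) auto
  ultimately have "norm (U m - V m) \<le> (C + C') * 0"
    by (intro LIMSEQ_le_const) auto
  then show "U m = V m" by simp
qed

section \<open>The Green function of the perturbed equation\<close>

text \<open>\<open>Bh\<close> gives the contraction in the norm weighted by \<open>h\<close>, used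
  for existence and bounds; \<open>BH\<close> gives the one in the plain supremum norm over
  \<open>m\<close>, used for uniqueness. The last conclusion supplies the diagonal estimate that a
  bound on \<open>G' n n\<close> alone does not give.\<close>

lemma green_perturb:
  fixes A B :: "int \<Rightarrow> 'a::banach \<Rightarrow>\<^sub>L 'a"
  assumes G: "green_function A G"
    and h: "\<And>m n. norm (G m n) \<le> h m n" "\<And>m n. 0 < h m n" "\<And>m n. h m n \<le> H n"
    and Bh: "\<And>m k n. h m (k + 1) * norm (B k) * h k n \<le> c k * h m n"
    and BH: "\<And>k. H (k + 1) * norm (B k) \<le> c k"
    and c: "c summable_on UNIV" "infsum c UNIV = \<theta>" "\<theta> < 1"
  obtains G' where "green_function (\<lambda>n. A n + B n) G'"
    and "\<And>m n. norm (G' m n) \<le> h m n / (1 - \<theta>)"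
    and "\<And>n. norm (id_blinfun - G' n n) \<le> norm (id_blinfun - G n n) + h n n / (1 - \<theta>) * \<theta>"
proof -
  define K where "K m k = G m (k + 1) o\<^sub>L B k" for m k
  have norm_K: "norm (K m k) \<le> norm (G m (k + 1)) * norm (B k)" for m k
    unfolding K_def by (rule norm_blinfun_compose)
  have K: "norm (K m k) \<le> c k" for m k
  proof -
    have "norm (G m (k + 1)) * norm (B k) \<le> H (k + 1) * norm (B k)"
      by (intro mult_right_mono order_trans[OF h(1) h(3)]) simp
    then show ?thesis using norm_K BH order_trans by meson
  qed
  have \<theta>: "0 \<le> \<theta>"
    using order_trans[OF norm_ge_zero K] by (simp flip: c(2) add: infsum_nonneg)
  have Kh: "norm (K m k) * h k n \<le> c k * h m n" for m k n
  proof -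
    have "norm (G m (k + 1)) * norm (B k) \<le> h m (k + 1) * norm (B k)"
      by (intro mult_right_mono h(1)) simp
    then have "norm (K m k) * h k n \<le> h m (k + 1) * norm (B k) * h k n"
      using norm_K[of m k] h(2)[of k n] by (intro mult_right_mono) auto
    then show ?thesis using Bh order_trans by meson
  qed
  \<comment> \<open>Each second index \<open>n\<close> is a separate fixed-point problem in
    \<open>m\<close>; \<open>n\<close> enters only through the inhomogeneity and the weight.\<close>
  have "\<exists>W. (\<forall>m. W m = G m n + (\<Sum>\<^sub>\<infinity>k. K m k o\<^sub>L W k)) \<and> (\<forall>m. norm (W m) \<le> h m n / (1 - \<theta>))" for n
    by (rule kernel_fixpoint_exists[OF Kh[of _ _ n] h(2)[of _ n] c(1,2) \<theta> c(3) h(1)[of _ n]])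
      blast
  then obtain W where
    W: "\<And>n. (\<forall>m. W n m = G m n + (\<Sum>\<^sub>\<infinity>k. K m k o\<^sub>L W n k)) \<and> (\<forall>m. norm (W n m) \<le> h m n / (1 - \<theta>))"
    by metis
  define G' where "G' m n = W n m" for m n
  have G'_eq: "G' m n = G m n + (\<Sum>\<^sub>\<infinity>k. K m k o\<^sub>L G' k n)" for m n
    unfolding G'_def by (rule W[THEN conjunct1, THEN spec])
  have G'_h: "norm (G' m n) \<le> h m n / (1 - \<theta>)" for m n
    unfolding G'_def by (rule W[THEN conjunct2, THEN spec])
  have G'_H: "norm (G' m n) \<le> H n / (1 - \<theta>)" for m n
    using G'_h[of m n] divide_right_mono[OF h(3)[of m n], of "1 - \<theta>"] c(3) by simp
  have summable: "(\<lambda>k. K m k o\<^sub>L F k) summable_on UNIV" if "\<And>k. norm (F k) \<le> S"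
    for m S and F :: "int \<Rightarrow> 'a \<Rightarrow>\<^sub>L 'a"
    using K c(1) that order_trans[OF norm_ge_zero that]
    by (intro kernel_infsum(1)[where h = "\<lambda>_. 1" and c = c and S = S]) auto
  have G'_summable: "(\<lambda>k. K m k o\<^sub>L G' k n) summable_on UNIV" for m n
    by (rule summable[OF G'_H])
  have compose_infsum: "T o\<^sub>L infsum f UNIV = (\<Sum>\<^sub>\<infinity>k. T o\<^sub>L f k)"
    if "f summable_on UNIV" for T :: "'a \<Rightarrow>\<^sub>L 'a" and f :: "int \<Rightarrow> 'a \<Rightarrow>\<^sub>L 'a"
    by (rule infsumI[symmetric])
      (rule has_sum_bounded_linear[OF blinfun_compose.bounded_linear_right has_sum_infsum[OF that]])
  have infsum_compose: "infsum f UNIV o\<^sub>L T = (\<Sum>\<^sub>\<infinity>k. f k o\<^sub>L T)"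
    if "f summable_on UNIV" for T :: "'a \<Rightarrow>\<^sub>L 'a" and f :: "int \<Rightarrow> 'a \<Rightarrow>\<^sub>L 'a"
    by (rule infsumI[symmetric])
      (rule has_sum_bounded_linear[OF blinfun_compose.bounded_linear_left has_sum_infsum[OF that]])
  have single: "((\<lambda>k. if k = j then F else 0) has_sum F) UNIV" for j :: int and F :: "'a \<Rightarrow>\<^sub>L 'a"
    by (rule has_sum_finite_neutralI[of "{j}"]) auto
  have unique: "U = V"
    if "\<And>m. norm (U m) \<le> C" "\<And>m. U m = g m + (\<Sum>\<^sub>\<infinity>k. K m k o\<^sub>L U k)"
      "\<And>m. norm (V m) \<le> C'" "\<And>m. V m = g m + (\<Sum>\<^sub>\<infinity>k. K m k o\<^sub>L V k)"
    for U V g :: "int \<Rightarrow> 'a \<Rightarrow>\<^sub>L 'a" and C C' :: real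
    by (rule kernel_fixpoint_unique[OF K c(1,2) \<theta> c(3) that])

  \<comment> \<open>This identity needs no uniqueness. The jump of \<open>G (m + 1) (k + 1)\<close>
    occurs at \<open>k = m\<close> only, and its contribution \<open>B m o\<^sub>L G' m n\<close>
    turns \<open>A m\<close> into \<open>A m + B m\<close>.\<close>
  have step_left: "G' (m + 1) n = ((A m + B m) o\<^sub>L G' m n) + (if m + 1 = n then id_blinfun else 0)"
    for m n
  proof -
    have "K (m + 1) k o\<^sub>L G' k n
      = (A m o\<^sub>L (K m k o\<^sub>L G' k n)) + (if k = m then B m o\<^sub>L G' m n else 0)" for k
      unfolding K_def by (subst green_step_left[OF G])
        (simp add: blinfun_compose.add_left blinfun_compose_assoc)
    then have "(\<Sum>\<^sub>\<infinity>k. K (m + 1) k o\<^sub>L G' k n)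
      = (\<Sum>\<^sub>\<infinity>k. (A m o\<^sub>L (K m k o\<^sub>L G' k n)) + (if k = m then B m o\<^sub>L G' m n else 0))"
      by simp
    also have "\<dots> = (A m o\<^sub>L (\<Sum>\<^sub>\<infinity>k. K m k o\<^sub>L G' k n)) + (B m o\<^sub>L G' m n)"
      by (intro infsumI has_sum_add single
          has_sum_bounded_linear[OF blinfun_compose.bounded_linear_right has_sum_infsum] G'_summable)
    finally have sum_eq: "(\<Sum>\<^sub>\<infinity>k. K (m + 1) k o\<^sub>L G' k n)
      = (A m o\<^sub>L (\<Sum>\<^sub>\<infinity>k. K m k o\<^sub>L G' k n)) + (B m o\<^sub>L G' m n)" .
    have "A m o\<^sub>L G' m n = (A m o\<^sub>L G m n) + (A m o\<^sub>L (\<Sum>\<^sub>\<infinity>k. K m k o\<^sub>L G' k n))"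
      by (subst G'_eq) (rule blinfun_compose.add_right)
    then show ?thesis
      using G'_eq[of "m + 1" n] green_step_left[OF G, of m n]
      by (simp only: sum_eq blinfun_compose.add_left) simp
  qed

  \<comment> \<open>The coefficient acts in the second variable, on which the kernel does not act;
    so the right-hand side, as a function of \<open>m\<close>, is shown to solve the equation that
    determines \<open>G'\<close> at \<open>n\<close>.\<close>
  have step_right: "G' m n = (G' m (n + 1) o\<^sub>L (A n + B n)) + (if m = n then id_blinfun else 0)"
    for m n
  proof -
    define Y where "Y m = (G' m (n + 1) o\<^sub>L (A n + B n)) + (if m = n then id_blinfun else 0)" for m
    have Y_le: "norm (Y m) \<le> H (n + 1) / (1 - \<theta>) * norm (A n + B n) + norm (id_blinfun :: 'a \<Rightarrow>\<^sub>L 'a)" for m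
      unfolding Y_def
      by (intro norm_triangle_mono order_trans[OF norm_blinfun_compose] mult_right_mono G'_H) auto
    have Y_eq: "Y m = G m n + (\<Sum>\<^sub>\<infinity>k. K m k o\<^sub>L Y k)" for m
    proof -
      have "K m k o\<^sub>L Y k
        = ((K m k o\<^sub>L G' k (n + 1)) o\<^sub>L (A n + B n)) + (if k = n then K m n else 0)" for k
        by (simp add: Y_def blinfun_compose.add_right blinfun_compose_assoc)
      then have "(\<Sum>\<^sub>\<infinity>k. K m k o\<^sub>L Y k)
        = (\<Sum>\<^sub>\<infinity>k. ((K m k o\<^sub>L G' k (n + 1)) o\<^sub>L (A n + B n)) + (if k = n then K m n else 0))"
        by simp
      also have "\<dots> = ((\<Sum>\<^sub>\<infinity>k. K m k o\<^sub>L G' k (n + 1)) o\<^sub>L (A n + B n)) + K m n"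
        by (intro infsumI has_sum_add single
            has_sum_bounded_linear[OF blinfun_compose.bounded_linear_left has_sum_infsum] G'_summable)
      also have "(\<Sum>\<^sub>\<infinity>k. K m k o\<^sub>L G' k (n + 1)) = G' m (n + 1) - G m (n + 1)"
        using G'_eq[of m "n + 1"] by (metis add_diff_cancel_left')
      \<comment> \<open>Since \<open>K m n\<close> is \<open>G m (n + 1) o\<^sub>L B n\<close>, it
        cancels the \<open>B n\<close> part of the subtracted term and leaves only
        \<open>A n\<close>.\<close>
      finally have "(\<Sum>\<^sub>\<infinity>k. K m k o\<^sub>L Y k)
        = (G' m (n + 1) o\<^sub>L (A n + B n)) - (G m (n + 1) o\<^sub>L A n)"
        by (simp add: K_def blinfun_compose.diff_left blinfun_compose.add_right)
      then show ?thesis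
        using green_step_right[OF G, of m n] by (simp only: Y_def) simp
    qed
    have "(\<lambda>m. G' m n) = Y"
      by (rule unique[OF G'_H G'_eq Y_le Y_eq])
    then have "G' m n = Y m" by (rule fun_cong)
    then show ?thesis by (simp only: Y_def)
  qed

  have vanish: "G' m n o\<^sub>L G' n n = 0" if "m < n" for m n
  proof -
    txt \<open>Both \<open>Y\<close> and the truncation \<open>Z\<close> of \<open>G'\<close> solve the fixed-point equation with
      inhomogeneity \<open>G m n G' n n\<close>.\<close>
    define Y where "Y m = G' m n o\<^sub>L G' n n" for m
    define Z where "Z m = (if n \<le> m then G' m n else 0)" for m
    have Y_le: "norm (Y m) \<le> H n / (1 - \<theta>) * norm (G' n n)" for m
      unfolding Y_def by (intro order_trans[OF norm_blinfun_compose] mult_right_mono G'_H) simp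
    have Z_le: "norm (Z m) \<le> H n / (1 - \<theta>)" for m
      using G'_H[of m n] order_trans[OF norm_ge_zero G'_H[of m n]] by (simp add: Z_def)
    have Y_eq: "Y m = (G m n o\<^sub>L G' n n) + (\<Sum>\<^sub>\<infinity>k. K m k o\<^sub>L Y k)" for m
    proof -
      have "Y m = (G m n o\<^sub>L G' n n) + ((\<Sum>\<^sub>\<infinity>k. K m k o\<^sub>L G' k n) o\<^sub>L G' n n)"
        unfolding Y_def by (subst G'_eq) (rule blinfun_compose.add_left)
      then show ?thesis
        by (simp only: infsum_compose[OF G'_summable] blinfun_compose_assoc Y_def)
    qed
    have Z_eq: "Z m = (G m n o\<^sub>L G' n n) + (\<Sum>\<^sub>\<infinity>k. K m k o\<^sub>L Z k)" for m
    proof -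
      have Z_summable: "(\<lambda>k. K m k o\<^sub>L Z k) summable_on UNIV"
        by (rule summable[OF Z_le])
      \<comment> \<open>Expanding \<open>G' n n\<close> by its own equation produces products
        \<open>G m n o\<^sub>L G n (k + 1)\<close>, to which the composition law of \<open>G\<close>
        applies.\<close>
      have "G m n o\<^sub>L G' n n = (G m n o\<^sub>L G n n) + (G m n o\<^sub>L (\<Sum>\<^sub>\<infinity>k. K n k o\<^sub>L G' k n))"
        by (subst G'_eq) (rule blinfun_compose.add_right)
      also have "\<dots> = (G m n o\<^sub>L G n n) + (\<Sum>\<^sub>\<infinity>k. (G m n o\<^sub>L G n (k + 1)) o\<^sub>L (B k o\<^sub>L G' k n))"
        unfolding compose_infsum[OF G'_summable] by (simp only: blinfun_compose_assoc K_def)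
      finally have G_G': "G m n o\<^sub>L G' n n
        = (G m n o\<^sub>L G n n) + (\<Sum>\<^sub>\<infinity>k. (G m n o\<^sub>L G n (k + 1)) o\<^sub>L (B k o\<^sub>L G' k n))" .
      show ?thesis
      proof (cases "n \<le> m")
        case True
        \<comment> \<open>The product survives exactly for \<open>k + 1 \<le> n\<close>, that is for
          \<open>k < n\<close>, where \<open>Z k\<close> is zero.\<close>
        have "(G m n o\<^sub>L G n (k + 1)) o\<^sub>L (B k o\<^sub>L G' k n) = (K m k o\<^sub>L G' k n) - (K m k o\<^sub>L Z k)" for k
          using True by (simp add: green_compose[OF G] K_def Z_def blinfun_compose_assoc)
        then have "(\<Sum>\<^sub>\<infinity>k. (G m n o\<^sub>L G n (k + 1)) o\<^sub>L (B k o\<^sub>L G' k n))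
          = (\<Sum>\<^sub>\<infinity>k. (K m k o\<^sub>L G' k n) + - (K m k o\<^sub>L Z k))"
          by simp
        also have "\<dots> = (\<Sum>\<^sub>\<infinity>k. K m k o\<^sub>L G' k n) + - (\<Sum>\<^sub>\<infinity>k. K m k o\<^sub>L Z k)"
          by (intro infsumI has_sum_add has_sum_uminus[THEN iffD2] has_sum_infsum G'_summable)
            (simp add: Z_summable)
        finally show ?thesis
          using True G'_eq[of m n] by (simp only: G_G') (simp add: green_compose[OF G] Z_def)
      next
        case False
        \<comment> \<open>Now it survives, with a minus sign, exactly for \<open>n \<le> k\<close>,
          where \<open>Z k\<close> is \<open>G' k n\<close>.\<close>
        have "(G m n o\<^sub>L G n (k + 1)) o\<^sub>L (B k o\<^sub>L G' k n) = - (K m k o\<^sub>L Z k)" for k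
          using False
          by (simp add: green_compose[OF G] K_def Z_def blinfun_compose_assoc blinfun_compose.minus_left)
        then have "(\<Sum>\<^sub>\<infinity>k. (G m n o\<^sub>L G n (k + 1)) o\<^sub>L (B k o\<^sub>L G' k n)) = - (\<Sum>\<^sub>\<infinity>k. K m k o\<^sub>L Z k)"
          by (simp add: infsum_uminus)
        then show ?thesis
          using False by (simp only: G_G') (simp add: green_compose[OF G] Z_def)
      qed
    qed
    have "Y = Z"
      by (rule unique[OF Y_le Y_eq Z_le Z_eq])
    then have "Y m = Z m" by simp
    then show ?thesis
      using that by (simp add: Y_def Z_def)
  qed

  have "norm (id_blinfun - G' n n) \<le> norm (id_blinfun - G n n) + h n n / (1 - \<theta>) * \<theta>" for n
  proof -
    have "id_blinfun - G' n n = (id_blinfun - G n n) - (\<Sum>\<^sub>\<infinity>k. K n k o\<^sub>L G' k n)"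
      by (subst G'_eq) simp
    also have "norm \<dots> \<le> norm (id_blinfun - G n n) + norm (\<Sum>\<^sub>\<infinity>k. K n k o\<^sub>L G' k n)"
      by (rule norm_triangle_ineq4)
    also have "norm (\<Sum>\<^sub>\<infinity>k. K n k o\<^sub>L G' k n) \<le> h n n / (1 - \<theta>) * \<theta>"
      using kernel_infsum(2)[OF Kh c(1), of "\<lambda>k. G' k n" "1 / (1 - \<theta>)" n n] G'_h c(2,3) by simp
    finally show ?thesis by simp
  qed
  moreover have "green_function (\<lambda>n. A n + B n) G'"
    unfolding green_function_def
    by (intro conjI allI impI step_left step_right vanish)
  ultimately show thesis
    using G'_h by (intro that)
qed

section \<open>A zeta series over the integers\<close>

text \<open>The nonnegative integers contribute the full zeta sum; for the negative ones the base
  starts at 2, so the term 1 is missing.\<close>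

lemma has_sum_zeta_int:
  assumes "1 < s"
  shows "((\<lambda>k::int. real_of_int (\<bar>k\<bar> + 1) powr (- s)) has_sum (2 * zeta_sum s - 1)) UNIV"
proof -
  have summable: "summable (\<lambda>k. real (Suc k) powr (- s))"
    using assms summable_real_powr_iff[of "- s"] by (subst summable_Suc_iff) simp
  then have "(\<lambda>k. real (Suc k) powr (- s)) sums zeta_sum s"
    unfolding zeta_sum_def by (rule summable_sums)
  then have zeta: "((\<lambda>k. real (Suc k) powr (- s)) has_sum zeta_sum s) UNIV"
    by (rule sums_nonneg_imp_has_sum) simp
  have "(\<lambda>k. real (Suc (Suc k)) powr (- s)) sums (zeta_sum s - 1)"
    using \<open>(\<lambda>k. real (Suc k) powr (- s)) sums zeta_sum s\<close>
    by (subst sums_Suc_iff[of "\<lambda>k. real (Suc k) powr (- s)"]) simp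
  then have zeta1: "((\<lambda>k. real (Suc (Suc k)) powr (- s)) has_sum (zeta_sum s - 1)) UNIV"
    by (rule sums_nonneg_imp_has_sum) simp
  define f where "f k = real_of_int (\<bar>k\<bar> + 1) powr (- s)" for k
  have "(f has_sum zeta_sum s) (range int)"
    by (subst has_sum_reindex) (use zeta in \<open>auto simp: f_def o_def add.commute\<close>)
  \<comment> \<open>The map \<open>\<lambda>k. - int k - 1\<close> enumerates the negative integers,
    with base \<open>k + 2\<close>.\<close>
  moreover have "(f has_sum (zeta_sum s - 1)) (range (\<lambda>k. - int k - 1))"
    by (subst has_sum_reindex) (use zeta1 in \<open>auto simp: f_def o_def inj_on_def abs_if add.commute\<close>)
  moreover have "range int \<inter> range (\<lambda>k. - int k - 1) = {}"
    by auto
  ultimately have "(f has_sum (zeta_sum s + (zeta_sum s - 1))) (range int \<union> range (\<lambda>k. - int k - 1))"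
    by (rule has_sum_Un_disjoint)
  moreover have "range int \<union> range (\<lambda>k. - int k - 1) = UNIV"
  proof -
    have "k \<in> range int \<union> range (\<lambda>k. - int k - 1)" for k
      by (cases k) auto
    then show ?thesis by blast
  qed
  ultimately show ?thesis
    by (simp add: f_def[abs_def])
qed

section \<open>Polynomial weights\<close>

text \<open>For \<open>p\<close> and \<open>q\<close> at least 1, \<open>p * q\<close> is at least
  \<open>p + q - 1\<close>, hence at least half of \<open>p + q\<close>. Raising this to a
  nonpositive power is the origin of the factor \<open>2 powr (- a)\<close> in
  \<open>\<theta>\<close>.\<close>

lemma powr_mult_le_half:
  fixes p q r s t :: real
  assumes "1 \<le> p" "1 \<le> q" "0 < r" "r \<le> p + q" "t \<le> s" "s \<le> 0"
  shows "p powr s * q powr s \<le> 2 powr (- t) * r powr s"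
proof -
  have "0 \<le> (p - 1) * (q - 1)"
    using assms by simp
  also have "(p - 1) * (q - 1) = p * q - p - q + 1"
    by (simp add: algebra_simps)
  finally have "p + q - 1 \<le> p * q" by simp
  with assms have "r / 2 \<le> p * q" by linarith
  have "p powr s * q powr s = (p * q) powr s"
    using assms by (simp add: powr_mult)
  also have "\<dots> \<le> (r / 2) powr s"
    using assms \<open>r / 2 \<le> p * q\<close> by (intro powr_mono2') auto
  also have "\<dots> = 2 powr (- s) * r powr s"
    using assms by (simp add: powr_divide powr_minus field_simps)
  also have "\<dots> \<le> 2 powr (- t) * r powr s"
    using assms by (intro mult_right_mono powr_mono) auto
  finally show ?thesis .
qed

text \<open>The first factor is at most 1 and the second is monotone; the power of 2 is slack that
  matches the constant of the preceding estimate.\<close>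

lemma powr_mult_le_right:
  fixes p q r s s' t :: real
  assumes "1 \<le> p" "0 < r" "r \<le> q" "s \<le> 0" "s' \<le> 0" "t \<le> 0"
  shows "p powr s' * q powr s \<le> 2 powr (- t) * r powr s"
proof -
  have "p powr s' \<le> p powr 0"
    using assms by (intro powr_mono) auto
  moreover have "2 powr 0 \<le> 2 powr (- t)"
    using assms by (intro powr_mono) auto
  ultimately have "p powr s' \<le> 2 powr (- t)"
    using assms by simp
  then show ?thesis
    using assms by (intro mult_mono powr_mono2') auto
qed

definition dichotomy_weight :: "real \<Rightarrow> real \<Rightarrow> int \<Rightarrow> int \<Rightarrow> real" where
  "dichotomy_weight a b m n =
    (if n \<le> m then real_of_int (m - n + 1) powr a else real_of_int (n - m + 1) powr b)"

lemma dichotomy_weight_pos: "0 < dichotomy_weight a b m n"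
  by (simp add: dichotomy_weight_def)

lemma dichotomy_weight_le_1:
  assumes "a \<le> 0" "b \<le> 0"
  shows "dichotomy_weight a b m n \<le> 1"
  using assms powr_mono[of a 0 "real_of_int (m - n + 1)"] powr_mono[of b 0 "real_of_int (n - m + 1)"]
  by (simp add: dichotomy_weight_def)

text \<open>If \<open>k\<close> lies between \<open>m\<close> and \<open>n\<close> (first and last
  case), both factors carry the exponent of the target and the half estimate applies; the last case
  yields \<open>2 powr (- b)\<close>, which \<open>a \<le> b\<close> absorbs. Otherwise the factor
  with the exponent of the target has at least its base, and the other is at most 1.\<close>

lemma dichotomy_weight_compose:
  assumes "a \<le> b" "b \<le> 0"
  shows "dichotomy_weight a b m (k + 1) * dichotomy_weight a b k n
    \<le> 2 powr (- a) * dichotomy_weight a b m n"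
proof -
  have a: "a \<le> 0" using assms by simp
  consider "n \<le> k" "k < m" | "n \<le> m" "m \<le> k" | "k < n" "n \<le> m"
    | "m < n" "n \<le> k" | "m < n" "k < m" | "m \<le> k" "k < n"
    by linarith
  then show ?thesis
  proof cases
    case 1
    then show ?thesis
      using powr_mult_le_half[of "m - k" "k - n + 1" "m - n + 1" a a] a
      by (simp add: dichotomy_weight_def)
  next
    case 2
    then show ?thesis
      using powr_mult_le_right[of "k - m + 2" "m - n + 1" "k - n + 1" a b a] assms a
      by (simp add: dichotomy_weight_def algebra_simps)
  next
    case 3
    then show ?thesis
      using powr_mult_le_right[of "n - k + 1" "m - n + 1" "m - k" a b a] assms a
      by (simp add: dichotomy_weight_def algebra_simps)
  next
    case 4
    then show ?thesis
      using powr_mult_le_right[of "k - n + 1" "n - m + 1" "k - m + 2" b a a] assms a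
      by (simp add: dichotomy_weight_def algebra_simps)
  next
    case 5
    then show ?thesis
      using powr_mult_le_right[of "m - k" "n - m + 1" "n - k + 1" b a a] assms a
      by (simp add: dichotomy_weight_def algebra_simps)
  next
    case 6
    then show ?thesis
      using powr_mult_le_half[of "k - m + 2" "n - k + 1" "n - m + 1" a b] assms
      by (simp add: dichotomy_weight_def algebra_simps)
  qed
qed

section \<open>Perturbation of polynomial dichotomies\<close>

theorem corollary4:
  fixes A B :: "int \<Rightarrow> 'a::banach \<Rightarrow>\<^sub>L 'a"
    and D \<epsilon> a b \<delta> \<gamma> \<theta> :: real
  assumes "D \<ge> 1" and "\<epsilon> \<ge> 0"
    and "general_dichotomy A
           (\<lambda>m n. D * real_of_int (m - n + 1) powr a * real_of_int (\<bar>n\<bar> + 1) powr \<epsilon>)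
           (\<lambda>m n. D * real_of_int (n - m + 1) powr b * real_of_int (\<bar>n\<bar> + 1) powr \<epsilon>)"
    and "\<delta> > 0"
    and "\<And>n. norm (B n) \<le> \<delta> * real_of_int (\<bar>n + 1\<bar> + 1) powr (- \<gamma>)"
    and "a \<le> b" and "b \<le> 0"
    and "\<epsilon> - \<gamma> < - 1"
    and "\<theta> = 2 powr (- a) * D * \<delta> * (2 * zeta_sum (\<gamma> - \<epsilon>) - 1)"
    and "\<theta> < 1"
  shows "general_dichotomy (\<lambda>n. A n + B n)
           (\<lambda>m n. D / (1 - \<theta>) * real_of_int (m - n + 1) powr a * real_of_int (\<bar>n\<bar> + 1) powr \<epsilon>)
           (\<lambda>m n. D / (1 - \<theta>) * real_of_int (n - m + 1) powr b * real_of_int (\<bar>n\<bar> + 1) powr \<epsilon>)"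
proof -
  \<comment> \<open>\<open>v\<close> collects what depends on \<open>n\<close> alone. As the weights
    are at most 1, it is also the majorant of \<open>h\<close> that is uniform in
    \<open>m\<close>.\<close>
  define v where "v n = D * real_of_int (\<bar>n\<bar> + 1) powr \<epsilon>" for n
  define h where "h m n = dichotomy_weight a b m n * v n" for m n
  \<comment> \<open>The shift in the bound on \<open>B k\<close> matches \<open>v (k + 1)\<close>,
    so the powers combine to the exponent \<open>\<epsilon> - \<gamma>\<close>; the constant is
    chosen so that the sum of \<open>c\<close> is exactly \<open>\<theta>\<close>.\<close>
  define c where "c k = 2 powr (- a) * D * \<delta> * real_of_int (\<bar>k + 1\<bar> + 1) powr (- (\<gamma> - \<epsilon>))" for k
  have a: "a \<le> 0" using assms(6,7) by simp
  have v_pos: "0 < v n" for n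
    using assms(1) by (simp add: v_def)
  have h_ge: "h m n = D * real_of_int (m - n + 1) powr a * real_of_int (\<bar>n\<bar> + 1) powr \<epsilon>"
    if "n \<le> m" for m n
    using that by (simp add: h_def v_def dichotomy_weight_def)
  have h_less: "h m n = D * real_of_int (n - m + 1) powr b * real_of_int (\<bar>n\<bar> + 1) powr \<epsilon>"
    if "m < n" for m n
    using that by (simp add: h_def v_def dichotomy_weight_def)
  have h_diag: "h n n = v n" for n
    by (simp add: h_def dichotomy_weight_def)
  have h_pos: "0 < h m n" for m n
    using v_pos by (simp add: h_def dichotomy_weight_pos)
  have h_le: "h m n \<le> v n" for m n
    using mult_right_mono[OF dichotomy_weight_le_1[OF a assms(7)], of "v n"] v_pos[of n]
    by (simp add: h_def)
  have vB: "2 powr (- a) * (v (k + 1) * norm (B k)) \<le> c k" for k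
  proof -
    have "v (k + 1) * norm (B k)
      \<le> v (k + 1) * (\<delta> * real_of_int (\<bar>k + 1\<bar> + 1) powr (- \<gamma>))"
      using v_pos[of "k + 1"] by (intro mult_left_mono assms(5)) simp
    also have "\<dots> = D * \<delta> * (real_of_int (\<bar>k + 1\<bar> + 1) powr \<epsilon> * real_of_int (\<bar>k + 1\<bar> + 1) powr (- \<gamma>))"
      by (simp add: v_def mult_ac)
    also have "\<dots> = D * \<delta> * real_of_int (\<bar>k + 1\<bar> + 1) powr (- (\<gamma> - \<epsilon>))"
      by (simp flip: powr_add)
    finally show ?thesis
      by (simp add: c_def mult.assoc)
  qed
  \<comment> \<open>The unweighted contraction would do without the power of 2; keeping it lets one
    \<open>c\<close> serve both norms.\<close>
  have BH: "v (k + 1) * norm (B k) \<le> c k" for k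
  proof -
    have "1 \<le> (2::real) powr (- a)"
      using a by (intro ge_one_powr_ge_zero) auto
    then have "1 * (v (k + 1) * norm (B k)) \<le> 2 powr (- a) * (v (k + 1) * norm (B k))"
      using v_pos[of "k + 1"] by (intro mult_right_mono) auto
    then show ?thesis
      using vB[of k] by simp
  qed
  have Bh: "h m (k + 1) * norm (B k) * h k n \<le> c k * h m n" for m k n
  proof -
    have "h m (k + 1) * norm (B k) * h k n
      = dichotomy_weight a b m (k + 1) * dichotomy_weight a b k n * (v (k + 1) * norm (B k) * v n)"
      by (simp add: h_def mult_ac)
    also have "\<dots> \<le> 2 powr (- a) * dichotomy_weight a b m n * (v (k + 1) * norm (B k) * v n)"
      using v_pos[of n] v_pos[of "k + 1"]
      by (intro mult_right_mono dichotomy_weight_compose assms(6,7)) auto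
    also have "\<dots> = 2 powr (- a) * (v (k + 1) * norm (B k)) * h m n"
      by (simp add: h_def mult_ac)
    also have "\<dots> \<le> c k * h m n"
      using h_pos[of m n] by (intro mult_right_mono vB) auto
    finally show ?thesis .
  qed
  have "(c has_sum \<theta>) UNIV"
  proof -
    \<comment> \<open>The shift by 1 permutes the integers, so the sum is unchanged.\<close>
    have "((\<lambda>k. real_of_int (\<bar>k\<bar> + 1) powr (- (\<gamma> - \<epsilon>))) has_sum (2 * zeta_sum (\<gamma> - \<epsilon>) - 1))
        (range (\<lambda>k::int. k + 1))"
      using has_sum_zeta_int[of "\<gamma> - \<epsilon>"] assms(8) by simp
    then have "((\<lambda>k::int. real_of_int (\<bar>k + 1\<bar> + 1) powr (- (\<gamma> - \<epsilon>)))
        has_sum (2 * zeta_sum (\<gamma> - \<epsilon>) - 1)) UNIV"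
      by (subst (asm) has_sum_reindex) (auto simp: inj_on_def o_def)
    then show ?thesis
      unfolding c_def assms(9) by (rule has_sum_cmult_right)
  qed
  then have c: "c summable_on UNIV" "infsum c UNIV = \<theta>"
    by (simp_all add: has_sum_imp_summable infsumI)

  obtain G where G: "green_function A G"
    and G_ge: "\<And>m n. n \<le> m \<Longrightarrow> norm (G m n)
      \<le> D * real_of_int (m - n + 1) powr a * real_of_int (\<bar>n\<bar> + 1) powr \<epsilon>"
    and G_less: "\<And>m n. m < n \<Longrightarrow> norm (G m n)
      \<le> D * real_of_int (n - m + 1) powr b * real_of_int (\<bar>n\<bar> + 1) powr \<epsilon>"
    and G_diag: "\<And>n. norm (id_blinfun - G n n)
      \<le> D * real_of_int (n - n + 1) powr b * real_of_int (\<bar>n\<bar> + 1) powr \<epsilon>"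
    by (rule green_if_general_dichotomy[OF assms(3)]) blast
  have G_h: "norm (G m n) \<le> h m n" for m n
    using G_ge[of n m] G_less[of m n] h_ge[of n m] h_less[of m n] by (cases "n \<le> m") auto
  obtain G' where G': "green_function (\<lambda>n. A n + B n) G'"
    and G'_h: "\<And>m n. norm (G' m n) \<le> h m n / (1 - \<theta>)"
    and G'_diag: "\<And>n. norm (id_blinfun - G' n n)
      \<le> norm (id_blinfun - G n n) + h n n / (1 - \<theta>) * \<theta>"
    by (rule green_perturb[OF G G_h h_pos h_le Bh BH c assms(10)]) blast
  show ?thesis
  proof (rule general_dichotomy_if_green[OF G'])
    fix m n :: int
    show "norm (G' m n) \<le> D / (1 - \<theta>) * real_of_int (m - n + 1) powr a * real_of_int (\<bar>n\<bar> + 1) powr \<epsilon>"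
      if "n \<le> m"
      using G'_h[of m n] h_ge[OF that] by simp
    show "norm (G' m n) \<le> D / (1 - \<theta>) * real_of_int (n - m + 1) powr b * real_of_int (\<bar>n\<bar> + 1) powr \<epsilon>"
      if "m < n"
      using G'_h[of m n] h_less[OF that] by simp
  next
    fix n
    \<comment> \<open>The two contributions add up without loss:
      \<open>1 + \<theta> / (1 - \<theta>) = 1 / (1 - \<theta>)\<close>.\<close>
    have "norm (id_blinfun - G' n n) \<le> v n + v n / (1 - \<theta>) * \<theta>"
      using G'_diag[of n] G_diag[of n] by (simp add: h_diag v_def)
    also have "\<dots> = v n / (1 - \<theta>)"
      using assms(10) by (simp add: field_simps)
    finally show "norm (id_blinfun - G' n n)
      \<le> D / (1 - \<theta>) * real_of_int (n - n + 1) powr b * real_of_int (\<bar>n\<bar> + 1) powr \<epsilon>"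
      by (simp add: v_def)
  qed
qed

end
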